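(* Let $X$ be a uniformly convex Banach space. Let $\Omega$ and $\Delta$ be nonempty, closed and convex subsets of $X$, and let $T:\Omega\cup\Delta\to\Omega\cup\Delta$ be a cyclic orbital contraction mapping. Then: (i) $T$ has a best proximity point $x^*\in\Omega$, i.e. $\|x^*-Tx^*\|=dist(\Omega,\Delta)$; (ii) $x^*$ is the unique fixed point of $T^2$; (iii) $\{T^{2n}x\}$ converges to $x^*$ for every $x\in\Omega$; (iv) $Tx^*$ is a best proximity point of $T$ in $\Delta$, and $\{T^{2n}y\}$ converges to $Tx^*$ for every $y\in\Delta$.
   Context: Convergence is in norm, and $d(x,y)=\|x-y\|$. For nonempty subsets $\Omega,\Delta$ of $X$, $dist(\Omega,\Delta)=\inf\{d(x,y):x\in\Omega,\ y\in\Delta\}$. "Uniformly convex" has its usual meaning for Banach spaces. Best proximity point: if $T:\Omega\cup\Delta\to\Omega\cup\Delta$ satisfies $T(\Omega)\subset\Delta$ and $T(\Delta)\subset\Omega$, a point $z\in\Omega\cup\Delta$ is a best proximity point of $T$ if $d(z,Tz)=dist(\Omega,\Delta)$. Cyclic orbital contraction: $T:\Omega\cup\Delta\to\Omega\cup\Delta$ is a cyclic orbital contraction mapping if (a) $T$ induces bounded orbits, i.e. for every $x\in\Omega\cup\Delta$ the orbit $\{T^nx:n\in\mathbb{N}\cup\{0\}\}$ is bounded ($T^0$ is the identity); (b) $T(\Omega)\subset\Delta$ and $T(\Delta)\subset\Omega$; (c) there is $\eta\in(0,1)$ such that for all $x\in\Omega$ and $y\in\Delta$, $$d(Tx,Ty)\le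 \eta\, S(x,y)+(1-\eta)\,dist(\Omega,\Delta),$$ where $S(x,y)$ is the supremum of all the numbers $d(T^ix,T^jx)$ with $i-j$ odd, $d(T^ky,T^ly)$ with $k-l$ odd, and $d(T^rx,T^sy)$ with $r-s$ even, all indices ranging over $\mathbb{N}\cup\{0\}$.
   Formalization: In (ii), uniqueness of the fixed point of T^2 is asserted only within Ω; over Ω∪Δ it fails whenever dist(Ω,Δ)>0, since Tx* in Δ is then a second fixed point (e.g. Ω={0}, Δ={1}, T swapping them). *)

theory Defs
  imports "HOL-Analysis.Analysis"
begin

text \<open>Clarkson's definition.\<close>

definition uniformly_convex :: "'a::real_normed_vector itself \<Rightarrow> bool" where
  "uniformly_convex _ \<longleftrightarrow>
     (\<forall>\<epsilon>::real. 0 < \<epsilon> \<and> \<epsilon> \<le> 2 \<longrightarrow>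
        (\<exists>\<delta>>0. \<forall>x y :: 'a. norm x = 1 \<and> norm y = 1 \<and> norm (x - y) \<ge> \<epsilon>
           \<longrightarrow> norm ((1/2) *\<^sub>R (x + y)) \<le> 1 - \<delta>))"

definition cyclic_map :: "'a set \<Rightarrow> 'a set \<Rightarrow> ('a \<Rightarrow> 'a) \<Rightarrow> bool" where
  "cyclic_map A B T \<longleftrightarrow> T ` A \<subseteq> B \<and> T ` B \<subseteq> A"

definition best_proximity_point ::
    "'a::metric_space set \<Rightarrow> 'a set \<Rightarrow> ('a \<Rightarrow> 'a) \<Rightarrow> 'a \<Rightarrow> bool" where
  "best_proximity_point A B T z \<longleftrightarrow> z \<in> A \<union> B \<and> dist z (T z) = setdist A B"

definition orbit_distances :: "('a::metric_space \<Rightarrow> 'a) \<Rightarrow> 'a \<Rightarrow> 'a \<Rightarrow> real set" where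
  "orbit_distances T x y =
     {dist ((T ^^ i) x) ((T ^^ j) x) | i j. odd (int i - int j)} \<union>
     {dist ((T ^^ k) y) ((T ^^ l) y) | k l. odd (int k - int l)} \<union>
     {dist ((T ^^ r) x) ((T ^^ s) y) | r s. even (int r - int s)}"

text \<open>
  The supremum in the contraction condition is taken over a bounded set of reals, because
  all orbits are required to be bounded. The map \<open>T\<close> is a total function on the type, but
  only its values on \<open>A \<union> B\<close> matter; that it maps \<open>A \<union> B\<close> into itself is part of
  \<^const>\<open>cyclic_map\<close>.
\<close>

definition cyclic_orbital_contraction ::
    "'a::metric_space set \<Rightarrow> 'a set \<Rightarrow> ('a \<Rightarrow> 'a) \<Rightarrow> bool" where
  "cyclic_orbital_contraction A B T \<longleftrightarrow>
     (\<forall>x\<in>A \<union> B. bounded (range (\<lambda>n. (T ^^ n) x))) \<and>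
     cyclic_map A B T \<and>
     (\<exists>\<eta>. 0 < \<eta> \<and> \<eta> < 1 \<and>
        (\<forall>x\<in>A. \<forall>y\<in>B.
           dist (T x) (T y) \<le> \<eta> * Sup (orbit_distances T x y) + (1 - \<eta>) * setdist A B))"

end

theory Submission
  imports Defs
begin

text \<open>
  Let \<open>D\<close> be the distance of the two sets and let \<open>S(x, y)\<close> be the supremum in the contraction
  condition. Every distance entering \<open>S(Tx, Ty)\<close> is of the form \<open>d(Ta, Tb)\<close> with \<open>S(a, b) \<le> S(x, y)\<close>,
  so that \<open>S(T\<^sup>nx, T\<^sup>ny) - D \<le> \<eta>\<^sup>n (S(x, y) - D)\<close>. By uniform convexity, two points of one set whose
  distances to a common point of the other set are close to \<open>D\<close> are close to each other; hence the
  even iterates converge, to a limit \<open>p\<close> on the first set and \<open>q\<close> on the second that do not depend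
  on the starting point, and \<open>d(p, q) = D\<close>. No continuity of \<open>T\<close> is available to
  conclude \<open>Tp = q\<close>. Instead, \<open>p\<close> and \<open>q\<close> are limits of their own even iterates, so \<open>S(p, q)\<close> is at
  most the maximum of \<open>S(Tp, Tq)\<close> and \<open>D\<close>, and therefore \<open>S(p, q) = D\<close>. In particular
  \<open>d(p, Tp) = D = d(p, q)\<close>, and uniform convexity gives \<open>Tp = q\<close>.
\<close>

section \<open>Uniform convexity and nearly closest points\<close>

text \<open>Clarkson's condition concerns unit vectors. Both norms here are forced close to
  \<open>D\<close>, so passing from \<open>u /\<^sub>R D\<close> and \<open>v /\<^sub>R D\<close> to
  \<open>sgn u\<close> and \<open>sgn v\<close> costs little, and the condition applies to the
  latter.\<close>

lemma uniformly_convex_norm_diff_less: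
  assumes uc: "uniformly_convex TYPE('a::real_normed_vector)" and "D > 0" "e > 0"
  shows "\<exists>\<delta>>0. \<forall>u v :: 'a. norm u \<le> D + \<delta> \<longrightarrow> norm v \<le> D + \<delta> \<longrightarrow> 2 * D \<le> norm (u + v)
           \<longrightarrow> norm (u - v) < e"
proof -
  \<comment> \<open>Half of \<open>e / D\<close> is reserved for the error of normalising; the cap 2
    keeps \<open>e'\<close> in the range of the definition.\<close>
  define e' where "e' = min 2 (e / (2 * D))"
  have "0 < e'" "e' \<le> 2"
    using assms by (auto simp: e'_def)
  from uc[unfolded uniformly_convex_def, THEN spec, THEN mp, OF conjI[OF this]]
  obtain d where "d > 0"
    and d: "\<And>x y :: 'a. norm x = 1 \<Longrightarrow> norm y = 1 \<Longrightarrow> norm (x - y) \<ge> e'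
              \<Longrightarrow> norm ((1/2) *\<^sub>R (x + y)) \<le> 1 - d"
    by blast
  \<comment> \<open>\<open>D / 2\<close> keeps the norms positive, \<open>e / 4\<close> leaves
    \<open>sgn u\<close> and \<open>sgn v\<close> at least \<open>e'\<close> apart, and
    \<open>d * D / 2\<close> keeps the total normalisation error at most \<open>d\<close>, below the
    gain \<open>2 * d\<close> from convexity.\<close>
  define \<delta> where "\<delta> = min (D / 2) (min (e / 4) (d * D / 2))"
  have "\<delta> > 0"
    using \<open>D > 0\<close> \<open>e > 0\<close> \<open>d > 0\<close> by (simp add: \<delta>_def)
  have \<delta>: "\<delta> \<le> D / 2" "\<delta> \<le> e / 4" "\<delta> \<le> d * D / 2"
    by (auto simp: \<delta>_def)
  have "norm (u - v) < e"
    if u: "norm u \<le> D + \<delta>" and v: "norm v \<le> D + \<delta>" and uv: "2 * D \<le> norm (u + v)" for u v :: 'a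
  proof (rule ccontr)
    assume "\<not> norm (u - v) < e"
    have close: "norm (sgn w - w /\<^sub>R D) \<le> \<delta> / D"
      if "norm w \<le> D + \<delta>" "D - \<delta> \<le> norm w" for w :: 'a
    proof -
      have "norm w > 0"
        using that(2) \<delta>(1) \<open>D > 0\<close> by linarith
      have "sgn w - w /\<^sub>R D = (inverse (norm w) - inverse D) *\<^sub>R w"
        by (simp add: sgn_div_norm scaleR_diff_left)
      then have "norm (sgn w - w /\<^sub>R D) = \<bar>inverse (norm w) - inverse D\<bar> * \<bar>norm w\<bar>"
        by simp
      also have "\<dots> = \<bar>(inverse (norm w) - inverse D) * norm w\<bar>"
        by (simp add: abs_mult)
      also have "(inverse (norm w) - inverse D) * norm w = (D - norm w) / D"
        using \<open>norm w > 0\<close> \<open>D > 0\<close> by (simp add: field_simps)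
      also have "\<bar>\<dots>\<bar> \<le> \<delta> / D"
        using that \<open>D > 0\<close> by (simp add: abs_le_iff divide_right_mono)
      finally show ?thesis .
    qed
    have nu: "D - \<delta> \<le> norm u" and nv: "D - \<delta> \<le> norm v"
      using u v uv norm_triangle_ineq[of u v] by linarith+
    note cu = close[OF u nu] and cv = close[OF v nv]
    have n1: "norm (sgn u) = 1" "norm (sgn v) = 1"
      using nu nv \<delta>(1) \<open>D > 0\<close> by (auto simp: norm_sgn)
    have "norm ((u - v) /\<^sub>R D)
        = norm ((sgn u - sgn v) - (sgn u - u /\<^sub>R D) + (sgn v - v /\<^sub>R D))"
      by (simp add: algebra_simps)
    also have "\<dots> \<le> norm (sgn u - sgn v) + norm (sgn u - u /\<^sub>R D) + norm (sgn v - v /\<^sub>R D)"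
      using norm_triangle_ineq[of "(sgn u - sgn v) - (sgn u - u /\<^sub>R D)" "sgn v - v /\<^sub>R D"]
        norm_triangle_ineq4[of "sgn u - sgn v" "sgn u - u /\<^sub>R D"] by linarith
    finally have "norm (u - v) / D \<le> norm (sgn u - sgn v) + 2 * (\<delta> / D)"
      using cu cv \<open>D > 0\<close> by (simp add: divide_inverse mult.commute)
    moreover have "e / D \<le> norm (u - v) / D"
      using \<open>\<not> norm (u - v) < e\<close> \<open>D > 0\<close> by (simp add: divide_right_mono)
    moreover have "2 * (\<delta> / D) \<le> e / (2 * D)"
      using \<delta>(2) \<open>D > 0\<close> by (simp add: field_simps)
    moreover have "e / D = 2 * (e / (2 * D))"
      by simp
    ultimately have "e' \<le> norm (sgn u - sgn v)"
      unfolding e'_def by linarith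
    from d[OF n1 this] have "norm (sgn u + sgn v) \<le> 2 * (1 - d)"
      by simp
    moreover have "norm ((u + v) /\<^sub>R D)
        = norm ((sgn u + sgn v) - (sgn u - u /\<^sub>R D) - (sgn v - v /\<^sub>R D))"
      by (simp add: algebra_simps)
    then have "norm ((u + v) /\<^sub>R D)
        \<le> norm (sgn u + sgn v) + norm (sgn u - u /\<^sub>R D) + norm (sgn v - v /\<^sub>R D)"
      using norm_triangle_ineq4[of "(sgn u + sgn v) - (sgn u - u /\<^sub>R D)" "sgn v - v /\<^sub>R D"]
        norm_triangle_ineq4[of "sgn u + sgn v" "sgn u - u /\<^sub>R D"] by linarith
    then have "norm (u + v) / D \<le> norm (sgn u + sgn v) + 2 * (\<delta> / D)"
      using cu cv \<open>D > 0\<close> by (simp add: divide_inverse mult.commute)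
    moreover have "2 \<le> norm (u + v) / D"
      using uv \<open>D > 0\<close> by (simp add: field_simps)
    moreover have "2 * (\<delta> / D) \<le> d"
      using \<delta>(3) \<open>D > 0\<close> by (simp add: field_simps)
    ultimately show False
      using \<open>d > 0\<close> by argo
  qed
  with \<open>\<delta> > 0\<close> show ?thesis
    by blast
qed

text \<open>For positive distance, the previous lemma applies to \<open>x - y\<close> and
  \<open>z - y\<close>: convexity keeps the midpoint of \<open>x\<close> and \<open>z\<close> in
  \<open>A\<close>, so the sum of these differences has norm at least twice the distance of the
  sets. For distance zero the triangle inequality suffices.\<close>

lemma uniformly_convex_setdist_close:
  fixes A B :: "'a::real_normed_vector set"
  assumes uc: "uniformly_convex TYPE('a)" and "convex A" and "e > 0"
  shows "\<exists>\<delta>>0. \<forall>x\<in>A. \<forall>z\<in>A. \<forall>y\<in>B. dist x y \<le> setdist A B + \<delta>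
           \<longrightarrow> dist z y \<le> setdist A B + \<delta> \<longrightarrow> dist x z < e"
proof (cases "setdist A B = 0")
  case True
  have "dist x z < e" if "dist x y \<le> setdist A B + e / 3" "dist z y \<le> setdist A B + e / 3" for x y z :: 'a
    using that True dist_triangle2[of x z y] \<open>e > 0\<close> by linarith
  moreover have "e / 3 > 0"
    using \<open>e > 0\<close> by simp
  ultimately show ?thesis
    by blast
next
  case False
  then have "setdist A B > 0"
    using setdist_pos_le[of A B] by linarith
  from uniformly_convex_norm_diff_less[OF uc this \<open>e > 0\<close>] obtain \<delta> where "\<delta> > 0"
    and \<delta>: "\<And>u v :: 'a. norm u \<le> setdist A B + \<delta> \<Longrightarrow> norm v \<le> setdist A B + \<delta>
              \<Longrightarrow> 2 * setdist A B \<le> norm (u + v) \<Longrightarrow> norm (u - v) < e"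
    by blast
  have "dist x z < e"
    if "x \<in> A" "z \<in> A" "y \<in> B" "dist x y \<le> setdist A B + \<delta>" "dist z y \<le> setdist A B + \<delta>" for x y z
  proof -
    have "midpoint x z \<in> A"
      using convexD[OF \<open>convex A\<close> that(1,2), of "1/2" "1/2"]
      by (simp add: midpoint_def scaleR_add_right)
    then have "setdist A B \<le> dist (midpoint x z) y"
      using that(3) by (rule setdist_le_dist)
    also have "(x - y) + (z - y) = 2 *\<^sub>R midpoint x z - 2 *\<^sub>R y"
      by (simp add: midpoint_def scaleR_2)
    then have "dist (midpoint x z) y = norm ((x - y) + (z - y)) / 2"
      by (simp add: dist_norm flip: scaleR_right_diff_distrib)
    finally have "norm ((x - y) - (z - y)) < e"
      using that(4,5) by (intro \<delta>) (auto simp: dist_norm)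
    then show ?thesis
      by (simp add: dist_norm)
  qed
  with \<open>\<delta> > 0\<close> show ?thesis
    by blast
qed

text \<open>The previous lemma with \<open>e = dist x z\<close> would give
  \<open>dist x z < dist x z\<close>. This later identifies limits and images by their distance to a
  common point.\<close>

lemma setdist_attained_unique:
  fixes A B :: "'a::real_normed_vector set"
  assumes "uniformly_convex TYPE('a)" "convex A" "x \<in> A" "z \<in> A" "y \<in> B"
    and "dist x y = setdist A B" "dist z y = setdist A B"
  shows "x = z"
proof (rule ccontr)
  assume "x \<noteq> z"
  then have "dist x z > 0"
    by simp
  from uniformly_convex_setdist_close[OF assms(1,2) this, of B]
  obtain \<delta> where "\<delta> > 0" and \<delta>: "\<And>u v w. u \<in> A \<Longrightarrow> v \<in> A \<Longrightarrow> w \<in> B \<Longrightarrow> dist u w \<le> setdist A B + \<delta>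
      \<Longrightarrow> dist v w \<le> setdist A B + \<delta> \<Longrightarrow> dist u v < dist x z"
    by blast
  have "dist x z < dist x z"
    using assms(6,7) \<open>\<delta> > 0\<close> by (intro \<delta>[OF assms(3-5)]) simp_all
  then show False
    by simp
qed

section \<open>Orbits split by parity\<close>

text \<open>
  For \<open>x\<close> in the first set and \<open>y\<close> in the second, this is the part of the two orbits that
  lies in the first set; the other part is obtained by exchanging \<open>x\<close> and \<open>y\<close>.
\<close>

definition parity_orbit :: "('a \<Rightarrow> 'a) \<Rightarrow> 'a \<Rightarrow> 'a \<Rightarrow> 'a set" where
  "parity_orbit T x y = {(T ^^ i) x | i. even i} \<union> {(T ^^ j) y | j. odd j}"

lemma funpow_in_parity_orbit:
  "even i \<Longrightarrow> (T ^^ i) x \<in> parity_orbit T x y"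
  "odd j \<Longrightarrow> (T ^^ j) y \<in> parity_orbit T x y"
  by (auto simp: parity_orbit_def)

lemma self_in_parity_orbit: "x \<in> parity_orbit T x y"
  using funpow_in_parity_orbit(1)[of 0 T x y] by simp

lemma image_in_parity_orbit: "T y \<in> parity_orbit T x y"
  using funpow_in_parity_orbit(2)[of 1 T y x] by simp

lemma image_parity_orbit:
  "T ` parity_orbit T x y = {(T ^^ Suc i) x | i. even i} \<union> {(T ^^ Suc j) y | j. odd j}"
  by (auto simp: parity_orbit_def)

lemma parity_orbit_image: "parity_orbit T (T x) (T y) = T ` parity_orbit T x y"
  unfolding image_parity_orbit by (simp add: parity_orbit_def funpow_swap1)

lemma image_parity_orbit_subset: "T ` parity_orbit T x y \<subseteq> parity_orbit T y x"
proof -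
  have "(T ^^ Suc i) x \<in> parity_orbit T y x" if "even i" for i
    using that by (intro funpow_in_parity_orbit) simp
  moreover have "(T ^^ Suc j) y \<in> parity_orbit T y x" if "odd j" for j
    using that by (intro funpow_in_parity_orbit) simp
  ultimately show ?thesis
    unfolding image_parity_orbit by blast
qed

text \<open>Separates the starting point, which need not be a value of \<open>T\<close>, from the
  points to which the contraction condition applies.\<close>

lemma parity_orbit_unfold: "parity_orbit T x y = insert x (T ` parity_orbit T y x)"
proof (intro antisym subsetI)
  fix a assume "a \<in> parity_orbit T x y"
  then consider i where "a = (T ^^ i) x" "even i" | j where "a = (T ^^ j) y" "odd j"
    unfolding parity_orbit_def by blast
  then show "a \<in> insert x (T ` parity_orbit T y x)"
  proof cases
    case (1 i)
    then show ?thesis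
      unfolding image_parity_orbit by (cases i) auto
  next
    case (2 j)
    then show ?thesis
      unfolding image_parity_orbit by (cases j) auto
  qed
next
  fix a assume "a \<in> insert x (T ` parity_orbit T y x)"
  then show "a \<in> parity_orbit T x y"
    using self_in_parity_orbit[of x T y] image_parity_orbit_subset[of T y x] by blast
qed

text \<open>\<open>T\<close> carries each part into the other, so the orbits of \<open>a\<close> and
  \<open>b\<close> never leave the two parts. This is the source of S(a, b) \<le> S(x, y).\<close>

lemma parity_orbit_mono:
  assumes a: "a \<in> parity_orbit T x y" and b: "b \<in> parity_orbit T y x"
  shows "parity_orbit T a b \<subseteq> parity_orbit T x y"
proof -
  have iter: "(if even i then (T ^^ i) u \<in> parity_orbit T v w else (T ^^ i) u \<in> parity_orbit T w v)"
    if "u \<in> parity_orbit T v w" for u v w i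
    by (induction i) (use that image_parity_orbit_subset[of T] in \<open>auto split: if_splits\<close>)
  show ?thesis
    using iter[OF a] iter[OF b] by (auto simp: parity_orbit_def[of T a b] split: if_splits)
qed

text \<open>Each of the three parity conditions says that the two points lie in opposite
  parts.\<close>

lemma orbit_distances_eq:
  "orbit_distances T x y = {dist a b | a b. a \<in> parity_orbit T x y \<and> b \<in> parity_orbit T y x}"
  (is "?L = ?R")
proof (intro antisym subsetI)
  fix d assume "d \<in> ?L"
  then consider
      i j where "d = dist ((T ^^ i) x) ((T ^^ j) x)" "odd (int i - int j)"
    | i j where "d = dist ((T ^^ i) y) ((T ^^ j) y)" "odd (int i - int j)"
    | i j where "d = dist ((T ^^ i) x) ((T ^^ j) y)" "even (int i - int j)"
    unfolding orbit_distances_def by blast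
  then show "d \<in> ?R"
  proof cases
    case 1
    then show ?thesis
      by (cases "even i") (auto, (metis dist_commute funpow_in_parity_orbit)+)
  next
    case 2
    then show ?thesis
      by (cases "even i") (auto, (metis dist_commute funpow_in_parity_orbit)+)
  next
    case 3
    then show ?thesis
      by (cases "even i") (auto, (metis dist_commute funpow_in_parity_orbit)+)
  qed
next
  fix d assume "d \<in> ?R"
  then obtain a b where d: "d = dist a b" and ab: "a \<in> parity_orbit T x y" "b \<in> parity_orbit T y x"
    by blast
  from ab show "d \<in> ?L"
    unfolding parity_orbit_def d orbit_distances_def
    by (auto, (metis dist_commute even_diff even_of_nat)+)
qed

section \<open>Orbital contractions in metric spaces\<close>

locale orbital_contraction =
  fixes A B :: "'a::metric_space set" and T :: "'a \<Rightarrow> 'a" and \<eta> :: real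
  assumes orbit_bounded: "x \<in> A \<union> B \<Longrightarrow> bounded (range (\<lambda>n. (T ^^ n) x))"
    and T_A: "x \<in> A \<Longrightarrow> T x \<in> B"
    and T_B: "x \<in> B \<Longrightarrow> T x \<in> A"
    and \<eta>: "0 < \<eta>" "\<eta> < 1"
    and contract: "x \<in> A \<Longrightarrow> y \<in> B \<Longrightarrow>
      dist (T x) (T y) \<le> \<eta> * Sup (orbit_distances T x y) + (1 - \<eta>) * setdist A B"
begin

text \<open>Exchanging the sets only swaps the two parts. Every fact about \<open>A\<close> thereby
  transfers to \<open>B\<close> with the same \<open>\<eta>\<close>.\<close>

lemma flipped: "orbital_contraction B A T \<eta>"
proof
  fix x y assume "x \<in> B" "y \<in> A"
  moreover have "orbit_distances T x y = orbit_distances T y x"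
    unfolding orbit_distances_eq by (metis dist_commute)
  ultimately show "dist (T x) (T y) \<le> \<eta> * Sup (orbit_distances T x y) + (1 - \<eta>) * setdist B A"
    using contract[of y x] by (simp add: dist_commute setdist_sym)
qed (use orbit_bounded T_A T_B \<eta> in auto)

lemma funpow_even_A: "x \<in> A \<Longrightarrow> (T ^^ (2 * n)) x \<in> A"
  by (induction n) (auto intro: T_A T_B)

lemma parity_orbit_A:
  assumes "x \<in> A" "y \<in> B"
  shows "parity_orbit T x y \<subseteq> A"
proof -
  have "(T ^^ (2 * n)) x \<in> A" "(T ^^ Suc (2 * n)) y \<in> A" for n
    using funpow_even_A[OF assms(1)] funpow_even_A[OF T_B[OF assms(2)]]
    by (simp_all only: funpow_Suc_right o_apply)
  then show ?thesis
    by (auto simp: parity_orbit_def elim!: evenE oddE)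
qed

text \<open>The contraction condition is used at \<open>a\<close> and \<open>b\<close>, whose own
  orbits stay in the parts by \<open>parity_orbit_mono\<close>. Since \<open>M\<close> may be any
  bound, estimates already obtained can be fed back in.\<close>

lemma dist_image_le:
  assumes "x \<in> A" "y \<in> B"
    and M: "\<And>a b. a \<in> parity_orbit T x y \<Longrightarrow> b \<in> parity_orbit T y x \<Longrightarrow> dist a b \<le> M"
    and a: "a \<in> parity_orbit T x y" and b: "b \<in> parity_orbit T y x"
  shows "dist (T a) (T b) \<le> \<eta> * M + (1 - \<eta>) * setdist A B"
proof -
  have "a \<in> A"
    using parity_orbit_A[OF assms(1,2)] a by blast
  moreover have "b \<in> B"
    using orbital_contraction.parity_orbit_A[OF flipped assms(2,1)] b by blast
  ultimately have "dist (T a) (T b) \<le> \<eta> * Sup (orbit_distances T a b) + (1 - \<eta>) * setdist A B"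
    by (rule contract)
  moreover have "Sup (orbit_distances T a b) \<le> M"
  proof (rule cSup_least)
    show "orbit_distances T a b \<noteq> {}"
      using self_in_parity_orbit[of a T b] self_in_parity_orbit[of b T a]
      unfolding orbit_distances_eq by blast
    fix d assume "d \<in> orbit_distances T a b"
    then obtain a' b' where "d = dist a' b'" "a' \<in> parity_orbit T a b" "b' \<in> parity_orbit T b a"
      unfolding orbit_distances_eq by blast
    then show "d \<le> M"
      using M parity_orbit_mono[OF a b] parity_orbit_mono[OF b a] by (metis subsetD)
  qed
  then have "\<eta> * Sup (orbit_distances T a b) \<le> \<eta> * M"
    using \<eta> by simp
  ultimately show ?thesis
    by linarith
qed

lemma dist_parity_orbits_bounded:
  assumes "x \<in> A" "y \<in> B"
  shows "\<exists>M. \<forall>a\<in>parity_orbit T x y. \<forall>b\<in>parity_orbit T y x. dist a b \<le> M"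
proof -
  have "bounded (range (\<lambda>n. (T ^^ n) x) \<union> range (\<lambda>n. (T ^^ n) y))"
    using orbit_bounded assms by simp
  moreover have "parity_orbit T x y \<subseteq> range (\<lambda>n. (T ^^ n) x) \<union> range (\<lambda>n. (T ^^ n) y)"
    "parity_orbit T y x \<subseteq> range (\<lambda>n. (T ^^ n) x) \<union> range (\<lambda>n. (T ^^ n) y)"
    by (auto simp: parity_orbit_def)
  ultimately show ?thesis
    unfolding bounded_two_points by (meson subsetD)
qed

text \<open>Two steps at a time, so that the roles of the two sets are not exchanged.\<close>

lemma dist_parity_orbits_decay:
  assumes xy: "x \<in> A" "y \<in> B"
    and M: "\<And>a b. a \<in> parity_orbit T x y \<Longrightarrow> b \<in> parity_orbit T y x \<Longrightarrow> dist a b \<le> setdist A B + M"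
    and "a \<in> parity_orbit T ((T ^^ (2 * n)) x) ((T ^^ (2 * n)) y)"
    and "b \<in> parity_orbit T ((T ^^ (2 * n)) y) ((T ^^ (2 * n)) x)"
  shows "dist a b \<le> setdist A B + \<eta> ^ (2 * n) * M"
  using assms(4,5)
proof (induction n arbitrary: a b)
  case 0
  then show ?case
    using M by simp
next
  case (Suc n)
  interpret flip: orbital_contraction B A T \<eta>
    by (rule flipped)
  let ?x = "(T ^^ (2 * n)) x" and ?y = "(T ^^ (2 * n)) y" and ?D = "setdist A B"
  have xy': "?x \<in> A" "?y \<in> B"
    using xy funpow_even_A flip.funpow_even_A by auto
  \<comment> \<open>The first of two factors \<open>\<eta>\<close>. After one application of
    \<open>T\<close> the points lie in the opposite sets, so the second factor comes from the
    flipped contraction.\<close>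
  have 1: "dist a b \<le> ?D + \<eta> * (\<eta> ^ (2 * n) * M)"
    if a: "a \<in> parity_orbit T (T ?x) (T ?y)" and b: "b \<in> parity_orbit T (T ?y) (T ?x)" for a b
  proof -
    obtain a' where "a = T a'" "a' \<in> parity_orbit T ?x ?y"
      using a unfolding parity_orbit_image by (rule imageE)
    moreover obtain b' where "b = T b'" "b' \<in> parity_orbit T ?y ?x"
      using b unfolding parity_orbit_image by (rule imageE)
    ultimately show ?thesis
      using dist_image_le[OF xy' Suc.IH, of a' b'] by (simp add: algebra_simps)
  qed
  have "(T ^^ (2 * Suc n)) x = T (T ?x)" "(T ^^ (2 * Suc n)) y = T (T ?y)"
    by simp_all
  with Suc.prems have ab: "a \<in> T ` parity_orbit T (T ?x) (T ?y)" "b \<in> T ` parity_orbit T (T ?y) (T ?x)"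
    by (simp_all only: parity_orbit_image)
  obtain a' where "a = T a'" "a' \<in> parity_orbit T (T ?x) (T ?y)"
    using ab(1) by (rule imageE)
  moreover obtain b' where "b = T b'" "b' \<in> parity_orbit T (T ?y) (T ?x)"
    using ab(2) by (rule imageE)
  ultimately show ?case
    using flip.dist_image_le[OF T_A[OF xy'(1)] T_B[OF xy'(2)] 1, of a' b']
    by (simp add: algebra_simps setdist_sym)
qed

lemma dist_even_iterates_le:
  assumes xy: "x \<in> A" "y \<in> B" and "e > 0"
  shows "\<exists>N. \<forall>m\<ge>N. \<forall>n\<ge>N. dist ((T ^^ (2 * m)) x) ((T ^^ (2 * n)) y) \<le> setdist A B + e"
proof -
  obtain M where M: "\<And>a b. a \<in> parity_orbit T x y \<Longrightarrow> b \<in> parity_orbit T y x \<Longrightarrow> dist a b \<le> M"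
    using dist_parity_orbits_bounded[OF xy] by blast
  have "(\<lambda>n. (\<eta>\<^sup>2) ^ n * (M - setdist A B)) \<longlonglongrightarrow> 0"
    using \<eta> by (intro tendsto_mult_left_zero LIMSEQ_realpow_zero) (auto simp: power_less_one_iff)
  from order_tendstoD(2)[OF this \<open>e > 0\<close>]
  obtain N where N: "\<eta> ^ (2 * N) * (M - setdist A B) < e"
    unfolding power_mult by (auto simp: eventually_sequentially)
  have "dist ((T ^^ (2 * m)) x) ((T ^^ (2 * n)) y) \<le> setdist A B + e" if "m \<ge> N" "n \<ge> N" for m n
  proof -
    \<comment> \<open>Late even iterates lie in the parity orbits started at the iterates of index
      \<open>2 * N\<close>, so decay at the single index \<open>N\<close> covers all
      \<open>m\<close> and \<open>n\<close>.\<close>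
    have iter: "(T ^^ (2 * k)) u \<in> parity_orbit T ((T ^^ (2 * N)) u) v" if "k \<ge> N" for k u v
    proof -
      have "2 * k = 2 * (k - N) + 2 * N"
        using that by simp
      then have "(T ^^ (2 * k)) u = (T ^^ (2 * (k - N))) ((T ^^ (2 * N)) u)"
        by (metis funpow_add o_apply)
      then show ?thesis
        by (simp only: funpow_in_parity_orbit dvd_triv_left)
    qed
    have "dist ((T ^^ (2 * m)) x) ((T ^^ (2 * n)) y) \<le> setdist A B + \<eta> ^ (2 * N) * (M - setdist A B)"
      by (rule dist_parity_orbits_decay[OF xy _ iter[OF \<open>m \<ge> N\<close>] iter[OF \<open>n \<ge> N\<close>]]) (simp add: M)
    with N show ?thesis
      by linarith
  qed
  then show ?thesis
    by blast
qed

text \<open>Late even iterates are within the distance of the sets plus any \<open>e > 0\<close>;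
  closedness gives the reverse bound at the limits.\<close>

lemma setdist_limits:
  assumes "x \<in> A" "y \<in> B" "closed A" "closed B"
    and p: "(\<lambda>n. (T ^^ (2 * n)) x) \<longlonglongrightarrow> p" and q: "(\<lambda>n. (T ^^ (2 * n)) y) \<longlonglongrightarrow> q"
  shows "p \<in> A" "q \<in> B" "dist p q = setdist A B"
proof -
  show pA: "p \<in> A"
    using \<open>closed A\<close> funpow_even_A[OF assms(1)] p by (rule closed_sequentially)
  show qB: "q \<in> B"
    using \<open>closed B\<close> orbital_contraction.funpow_even_A[OF flipped assms(2)] q
    by (rule closed_sequentially)
  have "dist p q \<le> setdist A B + e" if "e > 0" for e
  proof -
    obtain N where
      "\<And>m n. m \<ge> N \<Longrightarrow> n \<ge> N \<Longrightarrow> dist ((T ^^ (2 * m)) x) ((T ^^ (2 * n)) y) \<le> setdist A B + e"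
      using dist_even_iterates_le[OF assms(1,2) \<open>e > 0\<close>] by blast
    then show ?thesis
      by (intro LIMSEQ_le_const2[OF tendsto_dist[OF p q]]) blast
  qed
  then have "dist p q \<le> setdist A B"
    by (rule field_le_epsilon)
  with setdist_le_dist[OF pA qB] show "dist p q = setdist A B"
    by linarith
qed

text \<open>
  Every pair of points in the orbits of \<open>p\<close> and \<open>q\<close> other than \<open>(p, q)\<close> itself is a limit of
  pairs in the orbits of \<open>T p\<close> and \<open>T q\<close>, to which the contraction condition applies.
\<close>

lemma dist_parity_orbits_limit:
  assumes "p \<in> A" "q \<in> B" "dist p q = setdist A B"
    and p: "(\<lambda>n. (T ^^ (2 * n)) p) \<longlonglongrightarrow> p" and q: "(\<lambda>n. (T ^^ (2 * n)) q) \<longlonglongrightarrow> q"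
    and ab: "a \<in> parity_orbit T p q" "b \<in> parity_orbit T q p"
  shows "dist a b \<le> setdist A B"
proof -
  let ?P = "parity_orbit T p q" and ?Q = "parity_orbit T q p" and ?D = "setdist A B"
  obtain M0 where M0: "\<And>a b. a \<in> ?P \<Longrightarrow> b \<in> ?Q \<Longrightarrow> dist a b \<le> M0"
    using dist_parity_orbits_bounded[OF assms(1,2)] by blast
  define M where "M = Sup (orbit_distances T p q)"
  have bdd: "bdd_above (orbit_distances T p q)"
    unfolding orbit_distances_eq by (rule bdd_aboveI[of _ M0]) (auto intro: M0)
  have M: "dist a b \<le> M" if "a \<in> ?P" "b \<in> ?Q" for a b
    unfolding M_def by (rule cSup_upper[OF _ bdd]) (use that in \<open>auto simp: orbit_distances_eq\<close>)
  \<comment> \<open>\<open>c\<close> bounds distances between images. Once it bounds every orbit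
    distance, \<open>M \<le> c\<close> can be solved for \<open>M\<close> because
    \<open>\<eta> < 1\<close>, giving \<open>M \<le> ?D\<close>.\<close>
  define c where "c = \<eta> * M + (1 - \<eta>) * ?D"
  have "?D \<le> M"
    using M[OF self_in_parity_orbit self_in_parity_orbit] assms(3) by simp
  then have "\<eta> * ?D \<le> \<eta> * M"
    using \<eta> by simp
  then have "?D \<le> c"
    unfolding c_def by (simp add: algebra_simps)
  have image: "dist a b \<le> c" if "a \<in> T ` ?Q" "b \<in> T ` ?P" for a b
  proof -
    obtain a' b' where "a = T a'" "b = T b'" "a' \<in> ?Q" "b' \<in> ?P"
      using \<open>a \<in> T ` ?Q\<close> \<open>b \<in> T ` ?P\<close> by blast
    then show ?thesis
      using dist_image_le[OF assms(1,2) M, of b' a'] by (simp add: c_def dist_commute)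
  qed
  \<comment> \<open>For \<open>n = 0\<close> the iterate is \<open>u\<close> itself, which need not
    be an image.\<close>
  have even_image: "(T ^^ (2 * n)) u \<in> T ` parity_orbit T v u" if "n \<ge> 1" for n u v
  proof -
    have "(T ^^ (2 * n)) u = T ((T ^^ (2 * n - 1)) u)"
      using that by (cases n) auto
    moreover have "(T ^^ (2 * n - 1)) u \<in> parity_orbit T v u"
      using that by (intro funpow_in_parity_orbit) auto
    ultimately show ?thesis
      by blast
  qed
  \<comment> \<open>From \<open>n = 1\<close> on, the even iterates of \<open>p\<close> are images,
    so the bound \<open>c\<close> passes to their limit \<open>p\<close>.\<close>
  have p_image: "dist p b \<le> c" if "b \<in> T ` ?P" for b
    using image[OF even_image that]
    by (intro LIMSEQ_le_const2[OF tendsto_dist[OF p tendsto_const]]) blast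
  have q_image: "dist a q \<le> c" if "a \<in> T ` ?Q" for a
    using image[OF that even_image]
    by (intro LIMSEQ_le_const2[OF tendsto_dist[OF tendsto_const q]]) blast
  have "dist a b \<le> c" if "a \<in> ?P" "b \<in> ?Q" for a b
  proof -
    have "a \<in> insert p (T ` ?Q)" "b \<in> insert q (T ` ?P)"
      using that by (simp_all only: parity_orbit_unfold[symmetric])
    then consider "a = p" "b = q" | "a = p" "b \<in> T ` ?P" | "a \<in> T ` ?Q" "b = q"
      | "a \<in> T ` ?Q" "b \<in> T ` ?P"
      by blast
    then show ?thesis
    proof cases
      case 1
      then show ?thesis
        using \<open>?D \<le> c\<close> assms(3) by simp
    next
      case 2
      show ?thesis
        unfolding \<open>a = p\<close> by (rule p_image[OF 2(2)])
    next
      case 3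
      show ?thesis
        unfolding \<open>b = q\<close> by (rule q_image[OF 3(1)])
    next
      case 4
      then show ?thesis
        by (rule image)
    qed
  qed
  then have "d \<le> c" if "d \<in> orbit_distances T p q" for d
    using that unfolding orbit_distances_eq by blast
  moreover have "orbit_distances T p q \<noteq> {}"
    using self_in_parity_orbit[of p T q] self_in_parity_orbit[of q T p]
    unfolding orbit_distances_eq by blast
  ultimately have "M \<le> c"
    unfolding M_def by (intro cSup_least)
  then have "(1 - \<eta>) * M \<le> (1 - \<eta>) * ?D"
    unfolding c_def by (simp add: algebra_simps)
  then have "M \<le> ?D"
    using \<eta> by simp
  with M[OF ab] show ?thesis
    by simp
qed

text \<open>The orbit of \<open>T x\<close> is the companion in \<open>B\<close>: one late even
  iterate of it is nearly closest to all late even iterates of \<open>x\<close>. The locale concerns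
  metric spaces, so uniform convexity enters as \<open>close\<close>.\<close>

lemma even_iterates_Cauchy:
  assumes close: "\<And>e. e > 0 \<Longrightarrow> \<exists>\<delta>>0. \<forall>u\<in>A. \<forall>v\<in>A. \<forall>w\<in>B.
      dist u w \<le> setdist A B + \<delta> \<longrightarrow> dist v w \<le> setdist A B + \<delta> \<longrightarrow> dist u v < e"
    and "x \<in> A"
  shows "Cauchy (\<lambda>n. (T ^^ (2 * n)) x)"
proof (rule metric_CauchyI)
  fix e :: real assume "e > 0"
  then obtain \<delta> where "\<delta> > 0" and \<delta>: "\<And>u v w. u \<in> A \<Longrightarrow> v \<in> A \<Longrightarrow> w \<in> B \<Longrightarrow>
      dist u w \<le> setdist A B + \<delta> \<Longrightarrow> dist v w \<le> setdist A B + \<delta> \<Longrightarrow> dist u v < e"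
    using close by meson
  have "T x \<in> B"
    using T_A \<open>x \<in> A\<close> by blast
  obtain N where N: "\<And>m n. m \<ge> N \<Longrightarrow> n \<ge> N \<Longrightarrow>
      dist ((T ^^ (2 * m)) x) ((T ^^ (2 * n)) (T x)) \<le> setdist A B + \<delta>"
    using dist_even_iterates_le[OF \<open>x \<in> A\<close> \<open>T x \<in> B\<close> \<open>\<delta> > 0\<close>] by blast
  have "dist ((T ^^ (2 * m)) x) ((T ^^ (2 * n)) x) < e" if "m \<ge> N" "n \<ge> N" for m n
    using funpow_even_A[OF \<open>x \<in> A\<close>] orbital_contraction.funpow_even_A[OF flipped \<open>T x \<in> B\<close>] N that
    by (intro \<delta>[of _ _ "(T ^^ (2 * N)) (T x)"]) auto
  then show "\<exists>N. \<forall>m\<ge>N. \<forall>n\<ge>N. dist ((T ^^ (2 * m)) x) ((T ^^ (2 * n)) x) < e"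
    by blast
qed

end

section \<open>Limits and best proximity points in Banach spaces\<close>

lemma orbital_contraction_convergent:
  fixes A B :: "'a::banach set"
  assumes "orbital_contraction A B T \<eta>" and uc: "uniformly_convex TYPE('a)" and "convex A"
    and "x \<in> A"
  shows "convergent (\<lambda>n. (T ^^ (2 * n)) x)"
proof -
  interpret orbital_contraction A B T \<eta>
    by fact
  have "Cauchy (\<lambda>n. (T ^^ (2 * n)) x)"
    using uniformly_convex_setdist_close[OF uc \<open>convex A\<close>] \<open>x \<in> A\<close> by (rule even_iterates_Cauchy)
  then show ?thesis
    by (rule Cauchy_convergent)
qed

theorem theorem2p7:
  fixes \<Omega> \<Delta> :: "'a::banach set" and T :: "'a \<Rightarrow> 'a"
  assumes "uniformly_convex TYPE('a)"
    and "\<Omega> \<noteq> {}" "closed \<Omega>" "convex \<Omega>"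
    and "\<Delta> \<noteq> {}" "closed \<Delta>" "convex \<Delta>"
    and "cyclic_orbital_contraction \<Omega> \<Delta> T"
  shows "\<exists>x\<in>\<Omega>.
           best_proximity_point \<Omega> \<Delta> T x \<and>
           ((T ^^ 2) x = x \<and> (\<forall>z\<in>\<Omega>. (T ^^ 2) z = z \<longrightarrow> z = x)) \<and>
           (\<forall>u\<in>\<Omega>. (\<lambda>n. (T ^^ (2 * n)) u) \<longlonglongrightarrow> x) \<and>
           (T x \<in> \<Delta> \<and> best_proximity_point \<Omega> \<Delta> T (T x) \<and>
            (\<forall>y\<in>\<Delta>. (\<lambda>n. (T ^^ (2 * n)) y) \<longlonglongrightarrow> T x))"
proof -
  from assms(8) obtain \<eta> where "0 < \<eta>" "\<eta> < 1"
    and "\<forall>x\<in>\<Omega>. \<forall>y\<in>\<Delta>.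
           dist (T x) (T y) \<le> \<eta> * Sup (orbit_distances T x y) + (1 - \<eta>) * setdist \<Omega> \<Delta>"
    unfolding cyclic_orbital_contraction_def by (elim conjE exE) (rule that)
  moreover have "\<forall>x\<in>\<Omega> \<union> \<Delta>. bounded (range (\<lambda>n. (T ^^ n) x))"
    and "T ` \<Omega> \<subseteq> \<Delta>" "T ` \<Delta> \<subseteq> \<Omega>"
    using assms(8) unfolding cyclic_orbital_contraction_def cyclic_map_def by simp_all
  ultimately have "orbital_contraction \<Omega> \<Delta> T \<eta>"
    by unfold_locales (auto simp: image_subset_iff)
  then interpret orbital_contraction \<Omega> \<Delta> T \<eta> .
  note uc = assms(1) and limits = setdist_limits[OF _ _ assms(3,6)]
  have uniq_\<Omega>: "u = v"
    if "u \<in> \<Omega>" "v \<in> \<Omega>" "w \<in> \<Delta>" "dist u w = setdist \<Omega> \<Delta>" "dist v w = setdist \<Omega> \<Delta>" for u v w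
    using that by (rule setdist_attained_unique[OF uc assms(4)])
  have uniq_\<Delta>: "u = v"
    if "u \<in> \<Delta>" "v \<in> \<Delta>" "w \<in> \<Omega>" "dist w u = setdist \<Omega> \<Delta>" "dist w v = setdist \<Omega> \<Delta>" for u v w
    using setdist_attained_unique[OF uc assms(7), of u v w \<Omega>] that
    by (simp add: dist_commute setdist_sym)
  note conv_\<Omega> = orbital_contraction_convergent[OF orbital_contraction_axioms uc assms(4), unfolded convergent_def]
  note conv_\<Delta> = orbital_contraction_convergent[OF flipped uc assms(7), unfolded convergent_def]
  obtain x0 y0 where x0: "x0 \<in> \<Omega>" and y0: "y0 \<in> \<Delta>"
    using assms(2,5) by blast
  obtain p where p: "(\<lambda>n. (T ^^ (2 * n)) x0) \<longlonglongrightarrow> p"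
    using conv_\<Omega>[OF x0] by blast
  obtain q where q: "(\<lambda>n. (T ^^ (2 * n)) y0) \<longlonglongrightarrow> q"
    using conv_\<Delta>[OF y0] by blast
  note pq = limits[OF x0 y0 p q]
  \<comment> \<open>The limits \<open>p'\<close> and \<open>p\<close> are both at minimal distance
    from the same \<open>q\<close>, hence equal.\<close>
  have lim_p: "(\<lambda>n. (T ^^ (2 * n)) u) \<longlonglongrightarrow> p" if "u \<in> \<Omega>" for u
  proof -
    obtain p' where p': "(\<lambda>n. (T ^^ (2 * n)) u) \<longlonglongrightarrow> p'"
      using conv_\<Omega>[OF \<open>u \<in> \<Omega>\<close>] by blast
    then have "p' = p"
      using limits[OF that y0 p' q] pq by (intro uniq_\<Omega>[of p' p q])
    with p' show ?thesis
      by simp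
  qed
  have lim_q: "(\<lambda>n. (T ^^ (2 * n)) v) \<longlonglongrightarrow> q" if "v \<in> \<Delta>" for v
  proof -
    obtain q' where q': "(\<lambda>n. (T ^^ (2 * n)) v) \<longlonglongrightarrow> q'"
      using conv_\<Delta>[OF \<open>v \<in> \<Delta>\<close>] by blast
    then have "q' = q"
      using limits[OF x0 that p q'] pq by (intro uniq_\<Delta>[of q' q p])
    with q' show ?thesis
      by simp
  qed
  \<comment> \<open>The limits do not depend on the starting point, so \<open>p\<close> and
    \<open>q\<close> are limits of their own even iterates.\<close>
  note le = dist_parity_orbits_limit[OF pq lim_p[OF pq(1)] lim_q[OF pq(2)]]
  \<comment> \<open>\<open>p\<close> and \<open>T p\<close> lie in opposite parts, so their distance
    is minimal; \<open>T p\<close> and \<open>q\<close> are then both closest to \<open>p\<close> in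
    \<open>\<Delta>\<close>.\<close>
  have "dist p (T p) = setdist \<Omega> \<Delta>"
    using le[OF self_in_parity_orbit image_in_parity_orbit] setdist_le_dist[OF pq(1) T_A[OF pq(1)]]
    by linarith
  then have Tp: "T p = q"
    using T_A[OF pq(1)] pq by (intro uniq_\<Delta>[of "T p" q p])
  have "dist (T q) q = setdist \<Omega> \<Delta>"
    using le[OF image_in_parity_orbit self_in_parity_orbit] setdist_le_dist[OF T_B[OF pq(2)] pq(2)]
    by linarith
  then have Tq: "T q = p"
    using T_B[OF pq(2)] pq by (intro uniq_\<Omega>[of "T q" p q])
  have uniq_fix: "z = p" if "z \<in> \<Omega>" "(T ^^ 2) z = z" for z
  proof -
    \<comment> \<open>The even iterates of such a \<open>z\<close> form a constant sequence, which
      must also tend to \<open>p\<close>.\<close>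
    have "(T ^^ (2 * n)) z = z" for n
      using that(2) by (induction n) (auto simp: numeral_2_eq_2)
    then show ?thesis
      using lim_p[OF that(1)] by (simp add: LIMSEQ_const_iff)
  qed
  have "best_proximity_point \<Omega> \<Delta> T p" "best_proximity_point \<Omega> \<Delta> T (T p)"
    using pq Tp Tq by (simp_all add: best_proximity_point_def dist_commute[of q])
  moreover have "(T ^^ 2) p = p"
    using Tp Tq by (simp add: numeral_2_eq_2)
  moreover have "T p \<in> \<Delta>"
    using Tp pq(2) by simp
  moreover have "\<forall>u\<in>\<Omega>. (\<lambda>n. (T ^^ (2 * n)) u) \<longlonglongrightarrow> p" "\<forall>y\<in>\<Delta>. (\<lambda>n. (T ^^ (2 * n)) y) \<longlonglongrightarrow> T p"
    unfolding Tp by (intro ballI lim_p lim_q; assumption)+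
  moreover have "\<forall>z\<in>\<Omega>. (T ^^ 2) z = z \<longrightarrow> z = p"
    using uniq_fix by (intro ballI impI)
  ultimately show ?thesis
    using pq(1) by (intro bexI[of _ p] conjI)
qed

end
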